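(* For every integer $n\ge 3$ we have $f(n+1)\in\{f(n),\,f(n)+1\}$ and $L(n+1)\in\{L(n),\,L(n)+1\}$.
   Context: For an integer $n\ge 3$, $f(n)$ denotes the least positive integer $k$ such that $\binom{n}{k}>\frac{2^n}{n+1}$, and $L(n)$ denotes the least positive integer $k$ such that $\binom{n}{k}>\frac{2^n}{n}$. (Such $k$ exist for all $n\ge 3$.) *)

theory Defs
  imports Complex_Main
begin

definition f_idx :: "nat \<Rightarrow> nat" where
  "f_idx n = (LEAST k. k > 0 \<and> real (n choose k) > 2 ^ n / (real n + 1))"

definition L_idx :: "nat \<Rightarrow> nat" where
  "L_idx n = (LEAST k. k > 0 \<and> real (n choose k) > 2 ^ n / real n)"

(* For n \<ge> 3 both sets of candidates are nonempty, so LEAST picks a genuine minimum: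
   the n - 1 coefficients with 0 < k < n have average (2^n - 2) / (n - 1) > 2^n / n. *)

lemma L_idx_exists:
  fixes n :: nat
  assumes "n \<ge> 3"
  shows "\<exists>k>0. real (n choose k) > 2 ^ n / real n"
proof (rule ccontr)
  assume "\<not> ?thesis"
  then have le: "real (n choose k) \<le> 2 ^ n / real n" if "k > 0" for k
    using that by (metis linorder_not_less)
  have "{..n} = insert 0 (insert n {1..<n})" using assms by auto
  then have "(\<Sum>k\<le>n. real (n choose k)) = 2 + (\<Sum>k=1..<n. real (n choose k))"
    using assms by (simp del: One_nat_def)
  moreover have "(\<Sum>k\<le>n. real (n choose k)) = 2 ^ n"
    by (simp add: choose_row_sum flip: of_nat_sum)
  moreover have "(\<Sum>k=1..<n. real (n choose k)) \<le> of_nat (card {1..<n}) * (2 ^ n / real n)"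
    by (rule sum_bounded_above) (use le in auto)
  ultimately have "2 ^ n \<le> 2 + (real n - 1) * (2 ^ n / real n)"
    using assms by (simp add: of_nat_diff)
  then have "(2::real) ^ n \<le> 2 * real n"
    using assms by (simp add: field_simps)
  moreover have "2 * n < 2 ^ n"
    using assms by (induction n rule: dec_induct) auto
  then have "real (2 * n) < real (2 ^ n)"
    by (simp only: of_nat_less_iff)
  then have "2 * real n < 2 ^ n"
    by simp
  ultimately show False by simp
qed

lemma f_idx_exists:
  fixes n :: nat
  assumes "n \<ge> 3"
  shows "\<exists>k>0. real (n choose k) > 2 ^ n / (real n + 1)"
proof -
  have "2 ^ n / (real n + 1) \<le> 2 ^ n / real n"
    using assms by (intro divide_left_mono) auto
  then show ?thesis
    using L_idx_exists[OF assms] by (meson le_less_trans)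
qed

end

theory Submission
  imports Defs
begin

text \<open>
  Both indices are instances of one construction: the least positive \<open>k\<close> with
  \<open>n choose k > 2 ^ n / a\<close>, where the weight \<open>a\<close> is \<open>n + 1\<close> for \<open>f_idx\<close> and \<open>n\<close> for \<open>L_idx\<close>;
  let \<open>b\<close> be the weight that belongs to \<open>n + 1\<close>.

  By the symmetry of the binomial coefficients such a least index \<open>k\<close> satisfies \<open>2 * k \<le> n\<close>
  (\<open>least_index_le_half\<close>).
  In this left half, the step from row \<open>n\<close> to row \<open>n + 1\<close> of Pascal's triangle is governed by
  \<open>(n + 1 choose k + 1) = (n + 1) / (k + 1) * (n choose k)\<close> and
  \<open>(n + 1 choose j) = (n + 1) / (n + 1 - j) * (n choose j)\<close>.
  For \<open>2 * k \<le> n\<close> and \<open>j < k\<close> the first factor is at least \<open>2 * (n + 1) / (n + 2)\<close>, the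
  second at most \<open>2 * (n + 1) / (n + 4)\<close>.
  Meanwhile the threshold grows from \<open>2 ^ n / a\<close> to \<open>2 ^ (n + 1) / b\<close>, that is, by the
  factor \<open>2 * a / b\<close>. For both indices this factor lies between those two bounds. Hence
  \<open>k + 1\<close> exceeds the new threshold because \<open>k\<close> exceeds the old one, and every positive
  \<open>j < k\<close> stays at or below the threshold (\<open>least_index_step\<close>).
\<close>

text \<open>The mirror image \<open>n - k\<close> of \<open>k\<close> is a candidate as well. Only for \<open>k = n\<close> is it not
  positive, and the weight is bounded by \<open>2 ^ n\<close> to exclude this case.\<close>

lemma least_index_le_half:
  fixes a :: real
  assumes a: "0 < a" "a \<le> 2 ^ n"
    and ex: "\<exists>k>0. real (n choose k) > 2 ^ n / a"
  shows "2 * (LEAST k. k > 0 \<and> real (n choose k) > 2 ^ n / a) \<le> n"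
proof -
  define P where "P k \<longleftrightarrow> k > 0 \<and> real (n choose k) > 2 ^ n / a" for k
  define k where "k = (LEAST k. P k)"
  have "P k"
    unfolding k_def by (rule LeastI_ex) (use ex in \<open>simp add: P_def\<close>)
  have "1 \<le> 2 ^ n / a"
    using a by simp
  then have "1 < real (n choose k)"
    using \<open>P k\<close> unfolding P_def by linarith
  then have coeff: "1 < n choose k"
    by simp
  have "k < n"
  proof (rule ccontr)
    assume "\<not> k < n"
    then have "n choose k \<le> 1"
      by (cases "k = n") (simp_all add: binomial_eq_0)
    with coeff show False
      by simp
  qed
  then have "P (n - k)"
    using \<open>P k\<close> by (simp add: P_def flip: binomial_symmetric)
  then have "k \<le> n - k"
    unfolding k_def by (rule Least_le)
  then show ?thesis
    using \<open>k < n\<close> unfolding k_def P_def by linarith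
qed

text \<open>The hypotheses on \<open>b\<close> compare the growth \<open>2 * a / b\<close> of the threshold with the two
  growth factors at the extreme positions: \<open>(n + 2) * a \<le> (n + 1) * b\<close> says
  \<open>2 * a / b \<le> (n + 1) / (k + 1)\<close> for \<open>k = n / 2\<close>, and \<open>(n + 1) * b \<le> (n + 4) * a\<close> says
  \<open>(n + 1) / (n + 1 - j) \<le> 2 * a / b\<close> for \<open>j = n / 2 - 1\<close>, the last index that can lie
  below the least one.\<close>

lemma least_index_step:
  fixes a b :: real
  assumes a: "0 < a" "a \<le> 2 ^ n" and b: "0 < b"
    and lower: "(real n + 2) * a \<le> (real n + 1) * b"
    and upper: "(real n + 1) * b \<le> (real n + 4) * a"
    and ex: "\<exists>k>0. real (n choose k) > 2 ^ n / a"
  defines "k \<equiv> LEAST k. k > 0 \<and> real (n choose k) > 2 ^ n / a"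
  shows "(LEAST k. k > 0 \<and> real ((n + 1) choose k) > 2 ^ (n + 1) / b) \<in> {k, k + 1}"
proof -
  define Q where "Q j \<longleftrightarrow> j > 0 \<and> real ((n + 1) choose j) > 2 ^ (n + 1) / b" for j
  have k_half: "2 * k \<le> n"
    unfolding k_def by (rule least_index_le_half[OF a ex])
  have k: "k > 0 \<and> real (n choose k) > 2 ^ n / a"
    unfolding k_def by (rule LeastI_ex) (fact ex)
  have "Q (k + 1)"
  proof -
    have absorb: "(real k + 1) * real ((n + 1) choose (k + 1)) = (real n + 1) * real (n choose k)"
      using arg_cong[OF Suc_times_binomial_eq[of n k], of real]
      by (simp add: algebra_simps del: binomial_Suc_Suc)
    have "2 * (real k + 1) * a \<le> (real n + 2) * a"
      using k_half a by (intro mult_right_mono) auto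
    then have "2 ^ n * (2 * (real k + 1) * a) \<le> 2 ^ n * ((real n + 1) * b)"
      using lower by (intro mult_left_mono) auto
    also have "\<dots> < (real n + 1) * b * (real (n choose k) * a)"
    proof -
      have "2 ^ n < real (n choose k) * a"
        using k a by (simp add: field_simps)
      then have "(real n + 1) * b * 2 ^ n < (real n + 1) * b * (real (n choose k) * a)"
        using b by (intro mult_strict_left_mono) auto
      then show ?thesis
        by (simp only: mult_ac)
    qed
    also have "\<dots> = (real k + 1) * a * (real ((n + 1) choose (k + 1)) * b)"
      using arg_cong[OF absorb, of "\<lambda>x. a * b * x"] by (simp only: mult_ac)
    finally have "(real k + 1) * a * 2 ^ (n + 1)
        < (real k + 1) * a * (real ((n + 1) choose (k + 1)) * b)"
      by (simp add: algebra_simps)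
    then have "2 ^ (n + 1) < real ((n + 1) choose (k + 1)) * b"
      by (rule mult_left_less_imp_less) (use a in simp)
    then show ?thesis
      using b by (simp add: Q_def field_simps)
  qed
  moreover have "\<not> Q j" if "j < k" for j
  proof (cases "j = 0")
    case False
    have below: "real (n choose j) \<le> 2 ^ n / a"
      using not_less_Least[OF that[unfolded k_def]] False by auto
    have j_half: "2 * j + 2 \<le> n"
      using that k_half by linarith
    have absorb: "(real n + 1 - real j) * real ((n + 1) choose j) = (real n + 1) * real (n choose j)"
      using arg_cong[OF binomial_absorb_comp[of "n + 1" j], of real] j_half
      by (simp add: of_nat_diff add.commute distrib_right)
    have "(real n + 4) * a \<le> 2 * (real n + 1 - real j) * a"
      using j_half a by (intro mult_right_mono) auto
    with upper have factor: "(real n + 1) * b \<le> 2 * (real n + 1 - real j) * a"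
      by linarith
    have "(real n + 1 - real j) * a * (real ((n + 1) choose j) * b)
        = (real n + 1) * b * (real (n choose j) * a)"
      using arg_cong[OF absorb, of "\<lambda>x. a * b * x"] by (simp only: mult_ac)
    also have "\<dots> \<le> (real n + 1) * b * 2 ^ n"
      using below a b by (intro mult_left_mono) (auto simp: field_simps)
    also have "\<dots> \<le> 2 * (real n + 1 - real j) * a * 2 ^ n"
      using factor by (intro mult_right_mono) auto
    finally have "(real n + 1 - real j) * a * (real ((n + 1) choose j) * b)
        \<le> (real n + 1 - real j) * a * 2 ^ (n + 1)"
      by (simp add: algebra_simps)
    then have "real ((n + 1) choose j) * b \<le> 2 ^ (n + 1)"
      by (rule mult_left_le_imp_le) (use a j_half in simp)
    then show ?thesis
      using b by (simp add: Q_def field_simps)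
  qed (simp add: Q_def)
  ultimately have "k \<le> (LEAST j. Q j)" "(LEAST j. Q j) \<le> k + 1"
    by (meson LeastI linorder_not_less) (rule Least_le, fact)
  then show ?thesis
    unfolding Q_def by auto
qed

theorem theorem1p1:
  fixes n :: nat
  assumes "n \<ge> 3"
  shows "f_idx (n + 1) \<in> {f_idx n, f_idx n + 1} \<and> L_idx (n + 1) \<in> {L_idx n, L_idx n + 1}"
proof
  have "n + 1 \<le> 2 ^ n"
    by (simp add: Suc_le_eq)
  then have "real (n + 1) \<le> real (2 ^ n)"
    by (simp only: of_nat_le_iff)
  then have weight: "real n + 1 \<le> 2 ^ n"
    by simp
  show "f_idx (n + 1) \<in> {f_idx n, f_idx n + 1}"
    using least_index_step[of "real n + 1" n "real (n + 1) + 1"] weight f_idx_exists[OF assms]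
    unfolding f_idx_def by (simp add: algebra_simps)
  show "L_idx (n + 1) \<in> {L_idx n, L_idx n + 1}"
    using least_index_step[of "real n" n "real (n + 1)"] weight L_idx_exists[OF assms] assms
    unfolding L_idx_def by (simp add: algebra_simps)
qed

end
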